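(* Let $a,b,c,d,\tau,\eta\in\mathbb{R}$ with $ad-bc=1$ and $b>0$, and let $O_A$ be the offset linear canonical transform with parameter $A=\left[\begin{array}{cc|c} a & b & \tau\\ c & d & \eta\end{array}\right]$. Let $f\in L^1(\mathbb{R})$ and $O_Af\in L^1(\mathbb{R})$. If $$\int_{\mathbb{R}^2}|f(t)\,O_Af(u)|\,e^{|tu/b|}\,\mathrm{d}t\,\mathrm{d}u<\infty,$$ then $f=0$.
   Context: Here $j$ denotes the imaginary unit. For real parameters $a,b,c,d,\tau,\eta$ with $ad-bc=1$ and $b>0$, the offset linear canonical transform (OLCT) of a function $f$ on $\mathbb{R}$ is $$O_Af(u)=\int_{-\infty}^{+\infty}f(t)K_A(t,u)\,\mathrm{d}t,\qquad K_A(t,u)=\frac{1}{\sqrt{j2\pi b}}\,e^{j\frac{a}{2b}t^2-j\frac{1}{b}t(u-\tau)-j\frac{1}{b}u(d\tau-b\eta)+j\frac{d}{2b}(u^2+\tau^2)}.$$ For $f\in L^1(\mathbb{R})$ the integral converges absolutely. Functions in $L^1(\mathbb{R})$ are identified when equal almost everywhere. *)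

theory Defs
  imports "HOL-Analysis.Analysis"
begin

text \<open>
  The offset linear canonical transform with parameter matrix \<open>[a b | \<tau>; c d | \<eta>]\<close>, for \<open>b > 0\<close>.
  The entry \<open>c\<close> does not occur in the kernel; it is constrained only by \<open>a d - b c = 1\<close>.
  The square root of \<open>2 \<pi> b \<i>\<close> is the principal one.
\<close>

definition olct_kernel ::
    "real \<Rightarrow> real \<Rightarrow> real \<Rightarrow> real \<Rightarrow> real \<Rightarrow> real \<Rightarrow> real \<Rightarrow> real \<Rightarrow> complex" where
  "olct_kernel a b c d \<tau> \<eta> t u =
     1 / csqrt (\<i> * of_real (2 * pi * b)) *
     exp (\<i> * of_real (a / (2 * b) * t\<^sup>2)
          - \<i> * of_real (1 / b * t * (u - \<tau>))
          - \<i> * of_real (1 / b * u * (d * \<tau> - b * \<eta>))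
          + \<i> * of_real (d / (2 * b) * (u\<^sup>2 + \<tau>\<^sup>2)))"

definition olct ::
    "real \<Rightarrow> real \<Rightarrow> real \<Rightarrow> real \<Rightarrow> real \<Rightarrow> real \<Rightarrow> (real \<Rightarrow> complex) \<Rightarrow> real \<Rightarrow> complex" where
  "olct a b c d \<tau> \<eta> f u = (LINT t|lebesgue. f t * olct_kernel a b c d \<tau> \<eta> t u)"

end

theory Submission
  imports Defs "HOL-Probability.Probability" "HOL-Complex_Analysis.Complex_Analysis"
    "HOL-Real_Asymp.Real_Asymp"
begin

text \<open>
  The proof is Hoermander's argument for Beurling's theorem. Up to a unimodular factor and a
  dilation, \<open>O\<^sub>A f\<close> is the Fourier transform of \<open>g = f \<cdot> chirp\<close>, so it suffices to treat \<open>g\<close> and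
  its Fourier transform. Convolution with a Gaussian preserves the hypothesis and replaces \<open>g\<close> by
  an entire function \<open>G\<close> of order at most 2 such that \<open>|G z| \<le> M |Im z|\<close> and \<open>|G x| M |x|\<close> is
  integrable on the real line.
  The primitive \<open>P\<close> of \<open>G z \<cdot> G (\<i> z)\<close> is then bounded on both axes. Since a quadrant is exactly
  critical for Phragmen-Lindeloef at order 2, one factor is rotated by \<open>- \<alpha>\<close>: this
  gives bounds on the boundary of the narrower sector \<open>\<alpha> \<le> arg z \<le> \<pi>/2\<close>, uniform in \<open>\<alpha>\<close>, and
  \<open>\<alpha>\<close> tends to 0. So \<open>P\<close> is constant by Liouville, \<open>G = 0\<close>, and \<open>f = 0\<close> by uniqueness
  of Fourier transforms.
\<close>

subsection \<open>A Phragmen-Lindeloef theorem for narrow sectors\<close>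

text \<open>At radius \<open>exp R\<close>, growth of order 2 loses against damping of exponent
  \<open>p > 2\<close>: with \<open>exp (2 * R)\<close> factored out of the exponent, what remains
  is \<open>A - e * exp (q * R)\<close>, which tends to minus infinity.\<close>

lemma growth_factor_tendsto_0:
  fixes A C e p :: real
  assumes "e > 0" "p > 2"
  shows "((\<lambda>R. C * exp (A * exp R ^ 2 - e * exp (p * R))) \<longlongrightarrow> 0) at_top"
proof -
  define q where "q = p - 2"
  have q: "q > 0" using assms by (simp add: q_def)
  have "filterlim (\<lambda>R. exp (2 * R) * (e * exp (q * R) - A)) at_top at_top"
    using assms(1) q by real_asymp
  then have "((\<lambda>R. exp (- (exp (2 * R) * (e * exp (q * R) - A)))) \<longlongrightarrow> 0) at_top"
    by (intro filterlim_compose[OF exp_at_bot] filterlim_uminus_at_bot[THEN iffD2]) simp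
  moreover have "- (exp (2 * R) * (e * exp (q * R) - A)) = A * exp R ^ 2 - e * exp (p * R)" for R
  proof -
    have "exp (2 * R) * exp (q * R) = exp (p * R)"
      by (simp add: mult_exp_exp q_def algebra_simps)
    then show ?thesis by (simp add: algebra_simps flip: exp_double)
  qed
  ultimately show ?thesis by (simp add: tendsto_mult_right_zero)
qed

text \<open>The opening \<open>2 * \<phi>\<close> is less than a right angle, which leaves room for
  an exponent p above the order 2 of f for which z^p still has positive real part on the sector away
  from 0. The maximum principle is applied to f(z) exp(-e z^p) on a truncated sector, and then e
  tends to 0.\<close>

lemma phragmen_lindelof_sector:
  fixes f :: "complex \<Rightarrow> complex" and A B C \<phi> r \<theta> :: real
  assumes hol: "f holomorphic_on UNIV"
    and growth: "\<And>z. cmod (f z) \<le> C * exp (A * cmod z ^ 2)"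
    and \<phi>: "0 < \<phi>" "\<phi> < pi / 4"
    and upper: "\<And>r :: real. r \<ge> 0 \<Longrightarrow> cmod (f (r * cis \<phi>)) \<le> B"
    and lower: "\<And>r :: real. r \<ge> 0 \<Longrightarrow> cmod (f (r * cis (- \<phi>))) \<le> B"
    and r: "r \<ge> 0" and \<theta>: "\<bar>\<theta>\<bar> \<le> \<phi>"
  shows "cmod (f (r * cis \<theta>)) \<le> B"
proof (cases "r = 0")
  case True
  then show ?thesis using upper[of 0] by simp
next
  case False
  with r have "r > 0" by simp
  \<comment> \<open>The midpoint between the order 2 of f and the critical exponent
    \<open>pi / (2 * \<phi>)\<close> of the sector; \<open>\<phi> < pi / 4\<close> makes both
    inequalities strict.\<close>
  define p where "p = (2 + pi / (2 * \<phi>)) / 2"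
  have p: "2 < p" "p * \<phi> < pi / 2"
    using \<phi> by (auto simp: p_def field_simps)
  have p\<phi>: "p * \<phi> \<le> pi" using p(2) pi_gt_zero by linarith
  have cosp: "cos (p * \<phi>) > 0"
    using p \<phi> by (intro cos_gt_zero_pi) (auto intro: less_le_trans[of _ 0])
  have cosp_le: "cos (p * \<phi>) \<le> cos (p * y)" if "\<bar>y\<bar> \<le> \<phi>" for y
  proof -
    have "p * \<bar>y\<bar> \<le> p * \<phi>" using that p by (intro mult_left_mono) auto
    then have "cos (p * \<phi>) \<le> cos \<bar>p * y\<bar>"
      using p p\<phi> by (intro cos_monotone_0_pi_le) (simp_all add: abs_mult)
    then show ?thesis by simp
  qed
  have B: "B \<ge> 0" using upper[of 0] norm_ge_zero order_trans by blast
  define q where "q = exp (p * ln r) * cos (p * \<theta>)"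
  \<comment> \<open>The damping factor has modulus \<open>exp (- (e * q))\<close> at the given
    point, \<open>q\<close> being the real part of the p-th power of that point. The slack e in
    \<open>B + e\<close> pays for the two arcs: on the outer one the damped growth bound is small,
    on the inner one f is close to \<open>f 0\<close>, whose modulus is at most B.\<close>
  have bound: "cmod (f (r * cis \<theta>)) * exp (- (e * q)) \<le> B + e" if "e > 0" for e
  proof -
    have "\<forall>\<^sub>F R in at_top. C * exp (A * exp R ^ 2 - (e * cos (p * \<phi>)) * exp (p * R)) < B + e"
      using that cosp p B by (intro order_tendstoD(2)[OF growth_factor_tendsto_0]) auto
    moreover have "\<forall>\<^sub>F R in at_top. \<forall>s. Re s = - R \<longrightarrow> cmod (f (exp s)) < B + e"
    proof -
      have "isCont f 0"
        using hol by (meson UNIV_I continuous_on_eq_continuous_at holomorphic_on_imp_continuous_on open_UNIV)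
      then have "isCont (\<lambda>z. cmod (f z)) 0" by (intro continuous_intros)
      then have "((\<lambda>z. cmod (f z)) \<longlongrightarrow> cmod (f 0)) (nhds 0)"
        by (simp add: isCont_def tendsto_nhds_iff)
      then have "\<forall>\<^sub>F z in nhds 0. cmod (f z) < B + e"
        by (rule order_tendstoD(2)) (use upper[of 0] that in simp)
      then obtain d where d: "d > 0" "\<And>z. dist z 0 < d \<Longrightarrow> cmod (f z) < B + e"
        unfolding eventually_nhds_metric by auto
      have "((\<lambda>R. exp (- R)) \<longlongrightarrow> (0::real)) at_top" by real_asymp
      then have "\<forall>\<^sub>F R in at_top. exp (- R :: real) < d"
        using d(1) by (intro order_tendstoD(2)) auto
      then show ?thesis
        by eventually_elim (simp add: d(2))
    qed
    moreover have "\<forall>\<^sub>F R in at_top. R > \<bar>ln r\<bar>" by (rule eventually_gt_at_top)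
    ultimately have "\<forall>\<^sub>F R in at_top. C * exp (A * exp R ^ 2 - (e * cos (p * \<phi>)) * exp (p * R)) < B + e
        \<and> (\<forall>s. Re s = - R \<longrightarrow> cmod (f (exp s)) < B + e) \<and> R > \<bar>ln r\<bar>"
      by eventually_elim blast
    then obtain R where R: "C * exp (A * exp R ^ 2 - (e * cos (p * \<phi>)) * exp (p * R)) < B + e"
        "\<And>s. Re s = - R \<Longrightarrow> cmod (f (exp s)) < B + e" "R > \<bar>ln r\<bar>"
      using eventually_happens'[OF trivial_limit_at_top_linorder] by blast
    \<comment> \<open>In the coordinate \<open>s = ln z\<close> the sector is a strip and \<open>z\<^sup>p\<close> is the entire function \<open>exp (p s)\<close>.\<close>
    define H where "H s = f (exp s) * exp (- e * exp (p * s))" for s :: complex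
    have H: "cmod (H s) = cmod (f (exp s)) * exp (- (e * (exp (p * Re s) * cos (p * Im s))))" for s
      by (simp add: H_def norm_mult Re_exp)
    have holH: "H holomorphic_on X" for X
      unfolding H_def using hol
      by (intro holomorphic_intros holomorphic_on_compose_gen[of exp _ f UNIV, unfolded o_def]) auto
    let ?S = "cbox (Complex (- R) (- \<phi>)) (Complex R \<phi>)"
    have "cmod (H (Complex (ln r) \<theta>)) \<le> B + e"
    proof (rule maximum_modulus_frontier[of H ?S])
      show "H holomorphic_on interior ?S" "continuous_on (closure ?S) H"
        using holH holomorphic_on_imp_continuous_on by blast+
      show "bounded ?S" by (rule bounded_cbox)
      show "Complex (ln r) \<theta> \<in> ?S" using R(3) \<theta> by (auto simp: in_cbox_complex_iff)
    next
      fix s assume "s \<in> frontier ?S"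
      then have s: "\<bar>Re s\<bar> \<le> R" "\<bar>Im s\<bar> \<le> \<phi>" "Re s = R \<or> Re s = - R \<or> Im s = \<phi> \<or> Im s = - \<phi>"
        by (auto simp: frontier_cbox in_cbox_complex_iff in_box_complex_iff)
      have cs: "cos (p * \<phi>) \<le> cos (p * Im s)" by (rule cosp_le) (rule s)
      \<comment> \<open>The damping factor never exceeds 1 on the strip, so a bound on f suffices on
        three sides of the rectangle; only the side \<open>Re s = R\<close> uses its decay.\<close>
      have le1: "exp (- (e * (exp (p * Re s) * cos (p * Im s)))) \<le> 1"
        using cs cosp that by simp
      have *: "cmod (H s) \<le> B + e" if "cmod (f (exp s)) \<le> B + e"
        using mult_mono[OF that le1] B \<open>e > 0\<close> unfolding H by simp
      have ex: "exp s = exp (Re s) * cis (Im s)"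
        by (rule exp_eq_polar)
      from s(3) consider "Re s = R" | "Re s = - R" | "Im s = \<phi>" | "Im s = - \<phi>" by blast
      then show "cmod (H s) \<le> B + e"
      proof cases
        case 1
        have "cmod (H s) \<le> (C * exp (A * exp R ^ 2)) * exp (- (e * (exp (p * R) * cos (p * Im s))))"
          unfolding H using growth[of "exp s"] 1 by simp
        also have "\<dots> \<le> (C * exp (A * exp R ^ 2)) * exp (- (e * (exp (p * R) * cos (p * \<phi>))))"
        proof (rule mult_left_mono)
          show "exp (- (e * (exp (p * R) * cos (p * Im s)))) \<le> exp (- (e * (exp (p * R) * cos (p * \<phi>))))"
            using cs that by simp
          show "0 \<le> C * exp (A * exp R ^ 2)"
            using order_trans[OF norm_ge_zero growth[of "exp s"]] 1 by simp
        qed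
        also have "\<dots> = C * exp (A * exp R ^ 2 - (e * cos (p * \<phi>)) * exp (p * R))"
          by (simp only: mult.assoc mult_exp_exp) (simp add: algebra_simps)
        finally show ?thesis using R(1) by simp
      next
        case 2
        then show ?thesis using R(2)[of s] by (intro *) auto
      next
        case 3
        then show ?thesis using upper[of "exp (Re s)"] that by (intro *) (simp add: ex)
      next
        case 4
        then show ?thesis using lower[of "exp (Re s)"] that by (intro *) (simp add: ex)
      qed
    qed
    moreover have "exp (Complex (ln r) \<theta>) = r * cis \<theta>"
      using \<open>r > 0\<close> exp_eq_polar[of "Complex (ln r) \<theta>"] by simp
    ultimately show ?thesis by (simp add: H q_def)
  qed
  have "((\<lambda>e. cmod (f (r * cis \<theta>)) * exp (- (e * q))) \<longlongrightarrow> cmod (f (r * cis \<theta>)) * exp (- (0 * q))) (at_right 0)"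
    by (intro tendsto_intros)
  moreover have "((\<lambda>e. B + e) \<longlongrightarrow> B + 0) (at_right 0)"
    by (intro tendsto_intros)
  moreover have "\<forall>\<^sub>F e in at_right 0. cmod (f (r * cis \<theta>)) * exp (- (e * q)) \<le> B + e"
    using eventually_at_right_less[of 0] by eventually_elim (rule bound)
  ultimately show ?thesis
    using tendsto_le[OF trivial_limit_at_right_real] by fastforce
qed

section \<open>Primitives as integrals along rays\<close>

lemma primitive_has_integral:
  fixes P P' :: "complex \<Rightarrow> complex" and r :: real
  assumes P: "\<And>z. (P has_field_derivative P' z) (at z)" and r: "r \<ge> 0"
  shows "((\<lambda>s::real. P' (of_real s * u) * u) has_integral (P (of_real r * u) - P 0)) {0..r}"
proof -
  have "((\<lambda>s::real. P' (of_real s * u) * u) has_integral (P (of_real r * u) - P (of_real 0 * u))) {0..r}"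
  proof (rule fundamental_theorem_of_calculus[OF r])
    fix s assume "s \<in> {0..r}"
    have line: "((\<lambda>s::real. of_real s * u) has_vector_derivative u) (at s within {0..r})"
      using has_vector_derivative_mult_left[OF has_vector_derivative_of_real[OF DERIV_ident], of u]
      by simp
    show "((\<lambda>s. P (of_real s * u)) has_vector_derivative (P' (of_real s * u) * u)) (at s within {0..r})"
      using field_vector_diff_chain_within[OF line has_field_derivative_at_within[OF P]]
      by (simp add: o_def mult.commute)
  qed
  then show ?thesis by simp
qed

text \<open>The integral over \<open>{0..r}\<close> is enlarged to the whole line so that the bound
  does not depend on r. This is what bounds a primitive on the sides of a sector.\<close>

lemma ray_bound:
  fixes P P' :: "complex \<Rightarrow> complex" and w :: "real \<Rightarrow> real" and r \<theta> :: real
  assumes P: "\<And>z. (P has_field_derivative P' z) (at z)" and P0: "P 0 = 0"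
    and w: "integrable lborel w" "\<And>x. w x \<ge> 0"
    and le: "\<And>s. s \<ge> 0 \<Longrightarrow> cmod (P' (s * cis \<theta>)) \<le> w s"
    and r: "r \<ge> 0"
  shows "cmod (P (r * cis \<theta>)) \<le> (LINT x|lborel. w x)"
proof -
  note * = primitive_has_integral[OF P r, of "cis \<theta>"]
  have wi: "w integrable_on UNIV" "integral UNIV w = (LINT x|lborel. w x)"
    using integrable_on_lborel[OF w(1)] integral_lborel[OF w(1)] by auto
  have wi': "w integrable_on {0..r}"
    using integrable_on_subcbox[of w UNIV 0 r] wi(1) by simp
  have "cmod (integral {0..r} (\<lambda>s. P' (of_real s * cis \<theta>) * cis \<theta>)) \<le> integral {0..r} w"
    using * wi' le by (intro integral_norm_bound_integral) (auto simp: norm_mult)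
  also have "\<dots> \<le> integral UNIV w"
    using wi wi' w(2) by (intro integral_subset_le) auto
  finally show ?thesis
    using integral_unique[OF *] P0 wi(2) by simp
qed

subsection \<open>Entire functions of Beurling type\<close>

lemma entire_primitive:
  assumes "f holomorphic_on UNIV"
  obtains P where "\<And>z. (P has_field_derivative f z) (at z)" "P 0 = 0"
proof -
  obtain g where g: "\<And>z. z \<in> UNIV \<Longrightarrow> (g has_field_derivative f z) (at z within UNIV)"
    using holomorphic_convex_primitive'[OF convex_UNIV open_UNIV assms] by metis
  have "((\<lambda>z. g z - g 0) has_field_derivative f z) (at z)" for z
    using g[of z] by (auto intro!: derivative_eq_intros)
  then show thesis using that[of "\<lambda>z. g z - g 0"] by simp
qed

lemma holomorphic_on_UNIV_scale:
  assumes "f holomorphic_on UNIV"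
  shows "(\<lambda>z. f (c * z)) holomorphic_on UNIV"
proof -
  have "(f \<circ> (\<lambda>z. c * z)) holomorphic_on UNIV"
    by (rule holomorphic_on_compose_gen[OF _ assms]) (auto intro!: holomorphic_intros)
  then show ?thesis by (simp add: o_def)
qed

text \<open>Integrating over a fixed parameter interval gives both uniqueness of the primitive
  vanishing at 0 and its continuity in any parameter on which \<open>P'\<close> depends
  continuously.\<close>

lemma primitive_eq_integral:
  fixes P P' :: "complex \<Rightarrow> complex"
  assumes P: "\<And>z. (P has_field_derivative P' z) (at z)" and P0: "P 0 = 0"
  shows "P z = integral (cbox 0 1) (\<lambda>t::real. P' (t * z) * z)"
proof -
  have "((\<lambda>t::real. P' (of_real t * z) * z) has_integral (P (of_real 1 * z) - P 0)) {0..1}"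
    by (rule primitive_has_integral[OF P]) simp
  from integral_unique[OF this] P0 show ?thesis by simp
qed

text \<open>Integration costs a factor |z|, absorbed by |z| <= 1 + |z|^2 <= exp(|z|^2); hence order
  2 is kept and only the type grows, from A to A + 1.\<close>

lemma primitive_growth:
  fixes P P' :: "complex \<Rightarrow> complex"
  assumes P: "\<And>z. (P has_field_derivative P' z) (at z)" and P0: "P 0 = 0"
    and growth: "\<And>z. cmod (P' z) \<le> C * exp (A * cmod z ^ 2)" and A: "A \<ge> 0"
  shows "cmod (P z) \<le> C * exp ((A + 1) * cmod z ^ 2)"
proof -
  have C: "C \<ge> 0" using order_trans[OF norm_ge_zero growth[of 0]] by simp
  have "cmod (P z - P 0) \<le> (C * exp (A * cmod z ^ 2)) * cmod (z - 0)"
  proof (rule field_differentiable_bound[of "cball 0 (cmod z)" P P'])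
    fix w :: complex assume "w \<in> cball 0 (cmod z)"
    then have "cmod w ^ 2 \<le> cmod z ^ 2" by (intro power_mono) auto
    then have "C * exp (A * cmod w ^ 2) \<le> C * exp (A * cmod z ^ 2)"
      using A C by (intro mult_left_mono) (auto intro: mult_left_mono)
    with growth[of w] show "cmod (P' w) \<le> C * exp (A * cmod z ^ 2)" by simp
  qed (auto intro: has_field_derivative_at_within[OF P])
  also have "\<dots> \<le> (C * exp (A * cmod z ^ 2)) * exp (cmod z ^ 2)"
  proof (rule mult_left_mono)
    have "0 \<le> (cmod z - 1/2) ^ 2" by simp
    then have "cmod z \<le> 1 + cmod z ^ 2" by (simp add: power2_eq_square algebra_simps)
    also have "\<dots> \<le> exp (cmod z ^ 2)" by (rule exp_ge_add_one_self)
    finally show "cmod (z - 0) \<le> exp (cmod z ^ 2)" by simp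
  qed (use C in simp)
  finally show ?thesis using P0
    by (simp add: exp_add algebra_simps)
qed

section \<open>Boundedness in a quadrant and vanishing\<close>

text \<open>Two functions appear instead of one so that the other three quadrants reduce to this one
  by rotation, with G or its reflection in each place.\<close>

lemma bounded_in_quadrant:
  fixes G1 G2 P :: "complex \<Rightarrow> complex" and M :: "real \<Rightarrow> real" and A B C :: real
  assumes hol: "G1 holomorphic_on UNIV" "G2 holomorphic_on UNIV"
    and mono: "\<And>x y. 0 \<le> x \<Longrightarrow> x \<le> y \<Longrightarrow> M x \<le> M y"
    and G1: "\<And>z. cmod (G1 z) \<le> M \<bar>Im z\<bar>" and G2: "\<And>z. cmod (G2 z) \<le> M \<bar>Im z\<bar>"
    and growth: "\<And>x. x \<ge> 0 \<Longrightarrow> M x \<le> C * exp (A * x\<^sup>2)" and A: "A \<ge> 0"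
    and int1: "integrable lborel (\<lambda>x. cmod (G1 (of_real x)) * M \<bar>x\<bar>)"
    and B1: "(LINT x|lborel. cmod (G1 (of_real x)) * M \<bar>x\<bar>) \<le> B"
    and int2: "integrable lborel (\<lambda>x. cmod (G2 (of_real x)) * M \<bar>x\<bar>)"
    and B2: "(LINT x|lborel. cmod (G2 (of_real x)) * M \<bar>x\<bar>) \<le> B"
    and P: "\<And>z. (P has_field_derivative G1 z * G2 (\<i> * z)) (at z)" and P0: "P 0 = 0"
    and z: "Re z \<ge> 0" "Im z \<ge> 0"
  shows "cmod (P z) \<le> B"
proof -
  have M0: "M x \<ge> 0" if "x \<ge> 0" for x
    using order_trans[OF norm_ge_zero G1[of "\<i> * x"]] that by simp
  have C0: "C \<ge> 0" using order_trans[OF M0 growth, of 0] by simp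
  have cont: "continuous_on UNIV G1" "continuous_on UNIV G2"
    using hol holomorphic_on_imp_continuous_on by blast+
  \<comment> \<open>On the positive imaginary axis the argument \<open>\<i> * z\<close> of
    \<open>G2\<close> is a negative real, so the integral bound is also needed in reflected
    form.\<close>
  have int2': "integrable lborel (\<lambda>x. cmod (G2 (of_real (- x))) * M \<bar>x\<bar>)"
    using lborel_integrable_real_affine[OF int2, of "-1" 0] by simp
  have B2': "(LINT x|lborel. cmod (G2 (of_real (- x))) * M \<bar>x\<bar>) \<le> B"
    using lborel_integral_real_affine[of "-1" "\<lambda>x. cmod (G2 (of_real x)) * M \<bar>x\<bar>" 0] B2 by simp
  \<comment> \<open>On the ray of angle \<alpha> the argument of \<open>G1\<close> is real, and on
    the ray of angle pi/2 that of \<open>G2\<close> is. On each side of the sector the other factor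
    is at most \<open>M \<bar>s\<bar>\<close>, because its argument has imaginary part at most s in
    modulus and M is monotone. The resulting bound B is the same for all \<alpha>.\<close>
  define D where "D \<alpha> z = G1 (cis (- \<alpha>) * z) * G2 (\<i> * z)" for \<alpha> z
  have holD: "D \<alpha> holomorphic_on UNIV" for \<alpha>
    unfolding D_def
    by (intro holomorphic_on_mult holomorphic_on_UNIV_scale hol)
  have growthG: "cmod (G z) \<le> C * exp (A * cmod z ^ 2)" if "\<And>z. cmod (G z) \<le> M \<bar>Im z\<bar>" for G and z :: complex
  proof -
    have "cmod (G z) \<le> M (cmod z)"
      by (rule order_trans[OF that mono]) (auto simp: abs_Im_le_cmod)
    with growth[of "cmod z"] show ?thesis by simp
  qed
  have growthD: "cmod (D \<alpha> z) \<le> C\<^sup>2 * exp (2 * A * cmod z ^ 2)" for \<alpha> z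
  proof -
    have "cmod (D \<alpha> z) \<le> (C * exp (A * cmod z ^ 2)) * (C * exp (A * cmod z ^ 2))"
      unfolding D_def norm_mult
      using growthG[OF G1, of "cis (- \<alpha>) * z"] growthG[OF G2, of "\<i> * z"] C0
      by (intro mult_mono) (auto simp: norm_mult)
    also have "\<dots> = C\<^sup>2 * exp (2 * A * cmod z ^ 2)"
      by (simp add: power2_eq_square exp_double[symmetric] mult_exp_exp)
    finally show ?thesis .
  qed
  have ray1: "cmod (D \<alpha> (s * cis \<alpha>)) \<le> cmod (G1 (of_real s)) * M \<bar>s\<bar>" if "s \<ge> 0" for \<alpha> s :: real
  proof -
    have "cmod (G2 (\<i> * (s * cis \<alpha>))) \<le> M \<bar>s * cos \<alpha>\<bar>"
      using G2[of "\<i> * (s * cis \<alpha>)"] by simp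
    also have "\<dots> \<le> M \<bar>s\<bar>"
      by (rule mono) (auto simp: abs_mult intro: mult_left_le)
    finally show ?thesis
      by (simp add: D_def norm_mult mult_left_mono cis_mult mult.left_commute[of "cis _"])
  qed
  have ray2: "cmod (D \<alpha> (s * cis (pi / 2))) \<le> cmod (G2 (of_real (- s))) * M \<bar>s\<bar>" if "s \<ge> 0" for \<alpha> s :: real
  proof -
    have "cmod (G1 (cis (- \<alpha>) * (s * \<i>))) \<le> M \<bar>s * cos \<alpha>\<bar>"
      using G1[of "cis (- \<alpha>) * (s * \<i>)"] by (simp add: mult.commute)
    also have "\<dots> \<le> M \<bar>s\<bar>"
      by (rule mono) (auto simp: abs_mult intro: mult_left_le)
    finally have "cmod (G1 (cis (- \<alpha>) * (s * \<i>))) * cmod (G2 (- s)) \<le> M \<bar>s\<bar> * cmod (G2 (- s))"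
      by (rule mult_right_mono) simp
    moreover have "\<i> * (s * \<i>) = - s" by (simp add: complex_eq_iff)
    ultimately show ?thesis
      by (simp add: D_def norm_mult mult.commute cis_pi_half)
  qed
  have prim: "\<exists>Q. (\<forall>z. (Q has_field_derivative D \<alpha> z) (at z)) \<and> Q 0 = 0" for \<alpha>
    using entire_primitive[OF holD] by metis
  then obtain Q where Q: "\<And>\<alpha> z. (Q \<alpha> has_field_derivative D \<alpha> z) (at z)" "\<And>\<alpha>. Q \<alpha> 0 = 0"
    by metis
  have Q1: "cmod (Q \<alpha> (s * cis \<alpha>)) \<le> B" if "s \<ge> 0" for \<alpha> s :: real
    by (rule order_trans[OF ray_bound[OF Q int1 _ ray1 that] B1]) (auto intro!: mult_nonneg_nonneg M0)
  have Q2: "cmod (Q \<alpha> (s * cis (pi / 2))) \<le> B" if "s \<ge> 0" for \<alpha> s :: real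
    by (rule order_trans[OF ray_bound[OF Q int2' _ ray2 that] B2']) (auto intro!: mult_nonneg_nonneg M0)
  have sector: "cmod (Q \<alpha> (s * cis \<theta>)) \<le> B"
    if s: "s \<ge> 0" and \<alpha>: "0 < \<alpha>" "\<alpha> < \<theta>" "\<theta> < pi / 2" for \<alpha> \<theta> s :: real
  proof -
    \<comment> \<open>The bisecting angle and the half-opening of the sector between \<alpha> and
      pi/2. Rotation by \<open>cis \<beta>\<close> makes the sector symmetric about the positive
      real axis, and \<open>\<alpha> > 0\<close> gives \<open>\<phi> < pi / 4\<close>.\<close>
    define \<beta> where "\<beta> = (\<alpha> + pi / 2) / 2"
    define \<phi> where "\<phi> = (pi / 2 - \<alpha>) / 2"
    have "cmod (Q \<alpha> (cis \<beta> * (s * cis (\<theta> - \<beta>)))) \<le> B"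
    proof (rule phragmen_lindelof_sector[of "\<lambda>z. Q \<alpha> (cis \<beta> * z)" "C\<^sup>2" "2 * A + 1" \<phi>])
      have "Q \<alpha> holomorphic_on UNIV"
        using Q(1) by (auto simp: holomorphic_on_def field_differentiable_def)
      then show "(\<lambda>z. Q \<alpha> (cis \<beta> * z)) holomorphic_on UNIV"
        by (rule holomorphic_on_UNIV_scale)
      show "cmod (Q \<alpha> (cis \<beta> * z)) \<le> C\<^sup>2 * exp ((2 * A + 1) * (cmod z)\<^sup>2)" for z
        using primitive_growth[OF Q growthD, of \<alpha> "cis \<beta> * z"] A by (simp add: norm_mult)
      show "0 < \<phi>" "\<phi> < pi / 4" using \<alpha> by (auto simp: \<phi>_def)
      show "\<bar>\<theta> - \<beta>\<bar> \<le> \<phi>" using \<alpha> by (auto simp: \<phi>_def \<beta>_def abs_le_iff field_simps)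
      have "\<beta> + \<phi> = pi / 2" "\<beta> + - \<phi> = \<alpha>" by (auto simp: \<phi>_def \<beta>_def field_simps)
      then have rot: "cis \<beta> * (r * cis \<phi>) = r * cis (pi / 2)" "cis \<beta> * (r * cis (- \<phi>)) = r * cis \<alpha>" for r
        by (metis cis_mult mult.left_commute)+
      show "cmod (Q \<alpha> (cis \<beta> * (r * cis \<phi>))) \<le> B" "cmod (Q \<alpha> (cis \<beta> * (r * cis (- \<phi>)))) \<le> B"
        if "r \<ge> 0" for r :: real
        by (simp_all only: rot Q1[OF that] Q2[OF that])
    qed (rule s)
    then show ?thesis by (simp add: cis_mult mult.left_commute[of "cis \<beta>"])
  qed
  have QP: "Q 0 = P"
  proof
    have "D 0 = (\<lambda>z. G1 z * G2 (\<i> * z))" by (auto simp: D_def)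
    then show "Q 0 z = P z" for z
      using primitive_eq_integral[OF Q, of 0 z] primitive_eq_integral[OF P P0, of z] by simp
  qed
  obtain s \<theta> :: real where s: "s \<ge> 0" and zs: "z = s * cis \<theta>" and \<theta>: "0 \<le> \<theta>" "\<theta> \<le> pi / 2"
  proof (cases "z = 0")
    case True
    then show thesis by (intro that[of 0 0]) auto
  next
    case False
    then have "(Re z / cmod z)\<^sup>2 + (Im z / cmod z)\<^sup>2 = 1"
      using False by (auto simp: power_divide cmod_power2 complex_eq_iff simp flip: add_divide_distrib)
    then obtain t where t: "0 \<le> t" "t \<le> pi / 2" "Re z / cmod z = cos t" "Im z / cmod z = sin t"
      using sincos_total_pi_half[of "Re z / cmod z" "Im z / cmod z"] z by auto
    have "Re z = cmod z * cos t" "Im z = cmod z * sin t"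
      using False by (simp_all flip: t(3,4))
    then have "z = cmod z * cis t" by (simp add: complex_eq_iff)
    then show thesis using that[of "cmod z" t] t by auto
  qed
  \<comment> \<open>The limit \<alpha> -> 0 uses \<open>sector\<close>, which needs an angle
    strictly inside the quadrant; on the two axes the ray bounds at \<alpha> = 0 apply
    directly.\<close>
  consider "\<theta> = 0" | "\<theta> = pi / 2" | "0 < \<theta>" "\<theta> < pi / 2" using \<theta> by linarith
  then show ?thesis
  proof cases
    case 1
    then show ?thesis using Q1[of s 0] s zs QP by simp
  next
    case 2
    then show ?thesis using Q2[OF s, of 0] by (simp only: zs QP)
  next
    case 3
    have "continuous_on UNIV (\<lambda>\<alpha>. integral (cbox 0 1) (\<lambda>t. D \<alpha> (of_real t * z) * z))"
      unfolding D_def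
      by (intro integral_continuous_on_param, unfold case_prod_unfold cis_conv_exp)
         (intro continuous_on_mult continuous_on_compose2[OF cont(1)] continuous_on_compose2[OF cont(2)]
            continuous_intros; simp)
    then have "continuous_on UNIV (\<lambda>\<alpha>. cmod (Q \<alpha> z))"
      by (subst primitive_eq_integral[OF Q]) (intro continuous_intros)
    then have "((\<lambda>\<alpha>. cmod (Q \<alpha> z)) \<longlongrightarrow> cmod (Q 0 z)) (at_right 0)"
      by (simp add: continuous_on_def filterlim_at_split)
    moreover have "\<forall>\<^sub>F \<alpha> in at_right 0. cmod (Q \<alpha> z) \<le> B"
      using eventually_at_right_real[OF 3(1)]
      by eventually_elim (use sector s 3 zs in auto)
    ultimately show ?thesis
      using tendsto_upperbound[OF _ _ trivial_limit_at_right_real] QP by metis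
  qed
qed

text \<open>Boundedness in all four quadrants makes the primitive of
  \<open>G z * G (\<i> * z)\<close> constant, so this product is identically zero; by the identity
  theorem one factor, hence G itself, vanishes.\<close>

lemma beurling_entire_vanishes:
  fixes G :: "complex \<Rightarrow> complex" and M :: "real \<Rightarrow> real" and A C :: real
  assumes hol: "G holomorphic_on UNIV"
    and mono: "\<And>x y. 0 \<le> x \<Longrightarrow> x \<le> y \<Longrightarrow> M x \<le> M y"
    and G: "\<And>z. cmod (G z) \<le> M \<bar>Im z\<bar>"
    and growth: "\<And>x. x \<ge> 0 \<Longrightarrow> M x \<le> C * exp (A * x\<^sup>2)" and A: "A \<ge> 0"
    and int: "integrable lborel (\<lambda>x. cmod (G (of_real x)) * M \<bar>x\<bar>)"
  shows "G z = 0"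
proof -
  define B where "B = (LINT x|lborel. cmod (G (of_real x)) * M \<bar>x\<bar>)"
  define G' where "G' z = G (- z)" for z
  have hol': "G' holomorphic_on UNIV"
    unfolding G'_def using holomorphic_on_UNIV_scale[OF hol, of "- 1"] by simp
  have G': "cmod (G' z) \<le> M \<bar>Im z\<bar>" for z using G[of "- z"] by (simp add: G'_def)
  have int': "integrable lborel (\<lambda>x. cmod (G' (of_real x)) * M \<bar>x\<bar>)"
    using lborel_integrable_real_affine[OF int, of "-1" 0] by (simp add: G'_def)
  have B': "(LINT x|lborel. cmod (G' (of_real x)) * M \<bar>x\<bar>) \<le> B"
    using lborel_integral_real_affine[of "-1" "\<lambda>x. cmod (G (of_real x)) * M \<bar>x\<bar>" 0]
    by (simp add: B_def G'_def)
  have B: "(LINT x|lborel. cmod (G (of_real x)) * M \<bar>x\<bar>) \<le> B" by (simp add: B_def)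
  have hol_rot: "(\<lambda>z. G (c * z)) holomorphic_on UNIV" for c
    by (rule holomorphic_on_UNIV_scale[OF hol])
  have holP: "(\<lambda>z. G z * G (\<i> * z)) holomorphic_on UNIV"
    by (intro holomorphic_on_mult hol hol_rot)
  obtain P where P: "\<And>z. (P has_field_derivative G z * G (\<i> * z)) (at z)" and P0: "P 0 = 0"
    using entire_primitive[OF holP] by metis
  have rot: "((\<lambda>z. P (c * z) / c) has_field_derivative G (c * z) * G (\<i> * (c * z))) (at z)" if "c \<noteq> 0" for c z
  proof -
    have "((\<lambda>z. P (c * z)) has_field_derivative G (c * z) * G (\<i> * (c * z)) * c) (at z)"
      by (rule DERIV_chain2[OF P]) (auto intro!: derivative_eq_intros)
    from DERIV_cdivide[OF this, of c] that show ?thesis by simp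
  qed
  have bound: "cmod (P z) \<le> B" for z
  proof -
    \<comment> \<open>For c a power of the imaginary unit, \<open>P (c * w) / c\<close> is a
      primitive in w of \<open>G (c * w) * G (\<i> * (c * w))\<close>. Up to the order of the
      factors this has the form \<open>G1 w * G2 (\<i> * w)\<close> with \<open>G1\<close> and
      \<open>G2\<close> taken from G and its reflection, so every quadrant is covered by the
      first.\<close>
    have q: "cmod (P (c * w)) \<le> B"
      if "cmod c = 1" "G1 \<in> {G, G'}" "G2 \<in> {G, G'}" "Re w \<ge> 0" "Im w \<ge> 0"
        "\<And>z. G1 z * G2 (\<i> * z) = G (c * z) * G (\<i> * (c * z))" for c w G1 G2
    proof -
      have "c \<noteq> 0" using that(1) by auto
      have "cmod (P (c * w) / c) \<le> B"
        by (rule bounded_in_quadrant[of G1 G2 M C A B "\<lambda>z. P (c * z) / c"])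
           (use that rot[OF \<open>c \<noteq> 0\<close>] hol hol' mono G G' growth A int int' B B' P0 in auto)
      with that(1) show ?thesis by (simp add: norm_divide)
    qed
    have ii: "\<i> * (\<i> * w) = - w" for w by (simp add: complex_eq_iff)
    consider "Re z \<ge> 0" "Im z \<ge> 0" | "Re z \<le> 0" "Im z \<ge> 0" | "Re z \<le> 0" "Im z \<le> 0"
      | "Re z \<ge> 0" "Im z \<le> 0" by linarith
    then show ?thesis
    proof cases
      case 1
      then show ?thesis using q[of 1 G G z] by simp
    next
      case 2
      then show ?thesis using q[of \<i> G' G "- \<i> * z"]
        by (simp add: G'_def ii mult.commute[of "G (- z)" "G (\<i> * z)" for z])
    next
      case 3
      then show ?thesis using q[of "- 1" G' G' "- z"] by (simp add: G'_def)
    next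
      case 4
      then show ?thesis using q[of "- \<i>" G G' "\<i> * z"]
        by (simp add: G'_def ii mult.commute[of "G z" "G (- (\<i> * z))" for z])
    qed
  qed
  then have "bounded (range P)" by (auto simp: bounded_iff)
  moreover have "P holomorphic_on UNIV"
    using P by (auto simp: holomorphic_on_def field_differentiable_def)
  ultimately have "P constant_on UNIV" using Liouville_theorem by blast
  then obtain c where "P = (\<lambda>_. c)" by (auto simp: constant_on_def)
  then have prod0: "G z * G (\<i> * z) = 0" for z
    using DERIV_unique[OF P[of z]] DERIV_const by metis
  show ?thesis
  proof (rule ccontr)
    assume nz: "G z \<noteq> 0"
    have cont: "continuous_on UNIV G" using hol holomorphic_on_imp_continuous_on by blast
    have op: "open {w. G w \<noteq> 0}"
      by (rule open_Collect_neq[OF cont]) simp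
    \<comment> \<open>Where G is nonzero, which is a nonempty open set, the rotated function
      vanishes, so it vanishes everywhere; the point \<open>- \<i> * z\<close> is the one that it
      sends back to \<open>G z\<close>.\<close>
    have "G (\<i> * (- \<i> * z)) = 0"
    proof (rule analytic_continuation_open[of "{w. G w \<noteq> 0}" UNIV "\<lambda>w. G (\<i> * w)" "\<lambda>_. 0" "- \<i> * z"])
      show "G (\<i> * w) = 0" if "w \<in> {w. G w \<noteq> 0}" for w using prod0[of w] that by simp
    qed (use nz op hol_rot in auto)
    then show False using nz by simp
  qed
qed

subsection \<open>The Fourier transform on the line\<close>

text \<open>No normalizing constant: with this convention the phase is exactly t y, matching the
  weight exp |t y|.\<close>

definition fourier :: "(real \<Rightarrow> complex) \<Rightarrow> real \<Rightarrow> complex" where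
  "fourier g y = (CLBINT t. g t * iexp (- (t * y)))"

lemma integrable_fourier_integrand:
  fixes g :: "real \<Rightarrow> complex"
  assumes "integrable lborel g"
  shows "integrable lborel (\<lambda>t. g t * iexp (- (t * y)))"
  by (rule Bochner_Integration.integrable_bound[OF assms])
     (use borel_measurable_integrable[OF assms] in \<open>auto simp: norm_mult\<close>)

lemma norm_fourier_le:
  fixes g :: "real \<Rightarrow> complex"
  assumes "integrable lborel g"
  shows "cmod (fourier g y) \<le> (LBINT t. cmod (g t))"
proof -
  have "cmod (fourier g y) \<le> (LBINT t. cmod (g t * iexp (- (t * y))))"
    unfolding fourier_def by (rule integral_norm_bound)
  also have "\<dots> = (LBINT t. cmod (g t))" by (simp add: norm_mult)
  finally show ?thesis .
qed

lemma continuous_fourier: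
  fixes g :: "real \<Rightarrow> complex"
  assumes g: "integrable lborel g"
  shows "continuous_on UNIV (fourier g)"
proof (rule continuous_at_imp_continuous_on, rule ballI, rule continuous_at_sequentiallyI)
  fix y :: real and u assume "u \<longlonglongrightarrow> y"
  then show "(\<lambda>n. fourier g (u n)) \<longlonglongrightarrow> fourier g y"
    unfolding fourier_def
    using g borel_measurable_integrable[OF g]
    by (intro integral_dominated_convergence[where w = "\<lambda>t. cmod (g t)"])
       (auto simp: norm_mult intro!: tendsto_intros)
qed

section \<open>Uniqueness of Fourier transforms\<close>

text \<open>The positive and negative parts of g have equal transforms; at frequency 0 this says
  that they have equal mass m. If m > 0, dividing by m gives probability densities with the same
  characteristic function, and Levy's uniqueness theorem identifies them.\<close>

lemma AE_zero_of_fourier_zero_real: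
  fixes g :: "real \<Rightarrow> real"
  assumes g: "integrable lborel g"
    and zero: "\<And>y. fourier (\<lambda>t. of_real (g t)) y = 0"
  shows "AE t in lborel. g t = 0"
proof -
  have gm [measurable]: "g \<in> borel_measurable borel" using g by simp
  define p where "p t = max 0 (g t)" for t
  define n where "n t = max 0 (- g t)" for t
  have [measurable]: "p \<in> borel_measurable borel" "n \<in> borel_measurable borel"
    unfolding p_def n_def by measurable
  have p0: "p t \<ge> 0" and n0: "n t \<ge> 0" for t by (auto simp: p_def n_def)
  have gpn: "g t = p t - n t" for t by (auto simp: p_def n_def)
  have ip: "integrable lborel p" and "in": "integrable lborel n"
    by (rule Bochner_Integration.integrable_bound[OF g]; auto simp: p_def n_def)+
  have eq: "(CLBINT t. of_real (p t) * iexp (t * y)) = (CLBINT t. of_real (n t) * iexp (t * y))" for y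
  proof -
    have i: "integrable lborel (\<lambda>t. of_real (q t) * iexp (t * y))" if "integrable lborel q" for q :: "real \<Rightarrow> real"
      using integrable_fourier_integrand[of "\<lambda>t. of_real (q t)" "- y"] that by simp
    have "(CLBINT t. of_real (p t) * iexp (t * y)) - (CLBINT t. of_real (n t) * iexp (t * y))
        = fourier (\<lambda>t. of_real (g t)) (- y)"
      unfolding fourier_def Bochner_Integration.integral_diff[OF i[OF ip] i[OF "in"], symmetric]
      by (simp add: gpn algebra_simps)
    then show ?thesis using zero by simp
  qed
  define m where "m = (LBINT t. p t)"
  have m: "(LBINT t. n t) = m"
    using eq[of 0] by (simp add: m_def)
  have m0: "m \<ge> 0" unfolding m_def by (rule integral_nonneg_AE) (simp add: p0)
  show ?thesis
  proof (cases "m = 0")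
    case True
    then have "AE t in lborel. p t = 0" "AE t in lborel. n t = 0"
      using m integral_nonneg_eq_0_iff_AE[OF ip] integral_nonneg_eq_0_iff_AE[OF "in"] p0 n0
      by (auto simp: m_def)
    then show ?thesis by eventually_elim (simp add: gpn)
  next
    case False
    with m0 have "m > 0" by simp
    define D where "D q = density lborel (\<lambda>t. ennreal (q t / m))" for q :: "real \<Rightarrow> real"
    have rd: "real_distribution (D q)"
      if [measurable]: "q \<in> borel_measurable borel" and q: "integrable lborel q" "\<And>t. q t \<ge> 0" "(LBINT t. q t) = m" for q
    proof -
      have "(\<integral>\<^sup>+ t. ennreal (q t / m) \<partial>lborel) = ennreal (LBINT t. q t / m)"
        using q \<open>m > 0\<close> by (intro nn_integral_eq_integral) auto
      also have "\<dots> = 1" using q \<open>m > 0\<close> by simp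
      finally have "prob_space (D q)"
        unfolding D_def by (intro prob_spaceI) (simp add: emeasure_density)
      then show ?thesis
        by (simp add: real_distribution_def real_distribution_axioms_def D_def)
    qed
    have ch: "char (D q) y = (CLBINT t. of_real (q t) * iexp (t * y)) / m"
      if [measurable]: "q \<in> borel_measurable borel" and q: "\<And>t. q t \<ge> 0" for q y
    proof -
      have "char (D q) y = (CLBINT t. (q t / m) *\<^sub>R iexp (y * t))"
        unfolding char_def D_def using q \<open>m > 0\<close> by (subst integral_density) auto
      also have "\<dots> = (CLBINT t. of_real (q t) * iexp (t * y) / m)"
        by (intro Bochner_Integration.integral_cong) (auto simp: scaleR_conv_of_real mult.commute)
      finally show ?thesis by simp
    qed
    have "D p = D n"
      by (rule Levy_uniqueness) (use rd ip "in" p0 n0 m eq in \<open>auto simp: m_def ch fun_eq_iff\<close>)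
    then have "AE t in lborel. ennreal (p t / m) = ennreal (n t / m)"
      unfolding D_def by (subst (asm) sigma_finite_measure.density_unique_iff[OF sigma_finite_lborel]) auto
    then show ?thesis
      by eventually_elim (use \<open>m > 0\<close> p0 n0 in \<open>simp add: gpn\<close>)
  qed
qed

text \<open>Conjugating g conjugates and reflects its transform, so the transforms of the real and
  imaginary parts vanish too.\<close>

lemma AE_zero_of_fourier_zero:
  fixes g :: "real \<Rightarrow> complex"
  assumes g: "integrable lborel g" and zero: "\<And>y. fourier g y = 0"
  shows "AE t in lborel. g t = 0"
proof -
  have cnj0: "fourier (\<lambda>t. cnj (g t)) y = 0" for y
  proof -
    have "fourier (\<lambda>t. cnj (g t)) y = cnj (fourier g (- y))"
      unfolding fourier_def Bochner_Integration.integral_cnj[symmetric]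
      by (simp add: exp_cnj)
    then show ?thesis by (simp add: zero)
  qed
  have gc: "integrable lborel (\<lambda>t. cnj (g t))" using g by simp
  have Re: "fourier (\<lambda>t. of_real (Re (g t))) y = 0" for y
  proof -
    have "fourier (\<lambda>t. of_real (Re (g t))) y = (fourier g y + fourier (\<lambda>t. cnj (g t)) y) / 2"
      unfolding fourier_def
        Bochner_Integration.integral_add[OF integrable_fourier_integrand[OF g] integrable_fourier_integrand[OF gc], symmetric]
        Bochner_Integration.integral_divide_zero[symmetric]
      by (intro Bochner_Integration.integral_cong) (auto simp: distrib_right[symmetric] complex_add_cnj)
    then show ?thesis by (simp add: zero cnj0)
  qed
  have Im: "fourier (\<lambda>t. of_real (Im (g t))) y = 0" for y
  proof -
    have im: "complex_of_real (Im w) = (w - cnj w) / (2 * \<i>)" for w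
      by (simp add: complex_diff_cnj complex_eq_iff)
    have "fourier (\<lambda>t. of_real (Im (g t))) y = (fourier g y - fourier (\<lambda>t. cnj (g t)) y) / (2 * \<i>)"
      unfolding fourier_def
        Bochner_Integration.integral_diff[OF integrable_fourier_integrand[OF g] integrable_fourier_integrand[OF gc], symmetric]
        Bochner_Integration.integral_divide_zero[symmetric]
      by (intro Bochner_Integration.integral_cong) (simp_all add: im left_diff_distrib diff_divide_distrib)
    then show ?thesis by (simp add: zero cnj0)
  qed
  have "AE t in lborel. Re (g t) = 0" "AE t in lborel. Im (g t) = 0"
    using AE_zero_of_fourier_zero_real[OF integrable_Re[OF g] Re]
      AE_zero_of_fourier_zero_real[OF integrable_Im[OF g] Im] by auto
  then show ?thesis by eventually_elim (simp add: complex_eq_iff)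
qed

section \<open>Gaussian exponential moments\<close>

text \<open>Completing the square turns the Gaussian times exp(s y) into exp(s^2/2) times a shifted
  normal density. Since exp(r|y|) <= exp(r y) + exp(-r y), two such densities of mass 1 give the
  factor 2.\<close>

lemma integral_normal_density_exp_abs_le:
  fixes r :: real
  assumes r: "r \<ge> 0"
  shows "integrable lborel (\<lambda>y. std_normal_density y * exp (r * \<bar>y\<bar>))"
    and "(LBINT y. std_normal_density y * exp (r * \<bar>y\<bar>)) \<le> 2 * exp (r\<^sup>2 / 2)"
proof -
  have shift: "std_normal_density y * exp (s * y) = exp (s\<^sup>2 / 2) * normal_density s 1 y" for s y :: real
  proof -
    have "- y\<^sup>2 / 2 + s * y = s\<^sup>2 / 2 + - (y - s)\<^sup>2 / 2"
      by (simp add: power2_eq_square field_simps)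
    then show ?thesis
      by (simp add: normal_density_def mult_exp_exp)
  qed
  have le: "std_normal_density y * exp (r * \<bar>y\<bar>)
      \<le> exp (r\<^sup>2 / 2) * (normal_density r 1 y + normal_density (- r) 1 y)" for y
  proof -
    have "std_normal_density y * exp (r * \<bar>y\<bar>)
        \<le> std_normal_density y * exp (r * y) + std_normal_density y * exp (- r * y)"
      by (cases "y \<ge> 0") auto
    then show ?thesis unfolding shift by (simp add: distrib_left)
  qed
  have int: "integrable lborel (\<lambda>y. exp (r\<^sup>2 / 2) * (normal_density r 1 y + normal_density (- r) 1 y))"
    by (intro integrable_mult_right Bochner_Integration.integrable_add integrable_normal_density) auto
  show *: "integrable lborel (\<lambda>y. std_normal_density y * exp (r * \<bar>y\<bar>))"
    by (rule Bochner_Integration.integrable_bound[OF int]) (use le in \<open>auto simp: abs_of_nonneg\<close>)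
  have "(LBINT y. std_normal_density y * exp (r * \<bar>y\<bar>))
      \<le> (LBINT y. exp (r\<^sup>2 / 2) * (normal_density r 1 y + normal_density (- r) 1 y))"
    by (rule integral_mono[OF * int le])
  also have "\<dots> = 2 * exp (r\<^sup>2 / 2)" by simp
  finally show "(LBINT y. std_normal_density y * exp (r * \<bar>y\<bar>)) \<le> 2 * exp (r\<^sup>2 / 2)" .
qed

section \<open>Fourier-Laplace transforms and Gaussian smoothing\<close>

text \<open>The Taylor remainder of order zero; it dominates the difference quotients when
  differentiating under the integral.\<close>

lemma norm_exp_minus_one_le: "cmod (exp w - 1) \<le> exp \<bar>Re w\<bar> * cmod w"
  using Taylor_exp[of w 0] by simp

text \<open>The sign is opposite to that of \<open>fourier\<close>, so on the real line this acts as
  an unnormalized inverse transform.\<close>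

definition fourier_laplace :: "(real \<Rightarrow> complex) \<Rightarrow> complex \<Rightarrow> complex" where
  "fourier_laplace k z = (CLBINT y. k y * exp (\<i> * z * y))"

lemma fourier_laplace_integrable:
  assumes [measurable]: "k \<in> borel_measurable borel"
    and int: "\<And>r. r \<ge> 0 \<Longrightarrow> integrable lborel (\<lambda>y. cmod (k y) * exp (r * \<bar>y\<bar>))"
  shows "integrable lborel (\<lambda>y. k y * exp (\<i> * z * y))"
  by (rule Bochner_Integration.integrable_bound[OF int[of "\<bar>Im z\<bar>"]])
     (auto simp: norm_mult abs_mult[symmetric] intro!: mult_left_mono)

lemma norm_fourier_laplace_le:
  assumes [measurable]: "k \<in> borel_measurable borel"
    and int: "\<And>r. r \<ge> 0 \<Longrightarrow> integrable lborel (\<lambda>y. cmod (k y) * exp (r * \<bar>y\<bar>))"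
  shows "cmod (fourier_laplace k z) \<le> (LBINT y. cmod (k y) * exp (\<bar>Im z\<bar> * \<bar>y\<bar>))"
proof -
  have "cmod (fourier_laplace k z) \<le> (LBINT y. cmod (k y * exp (\<i> * z * y)))"
    unfolding fourier_laplace_def by (rule integral_norm_bound)
  also have "\<dots> \<le> (LBINT y. cmod (k y) * exp (\<bar>Im z\<bar> * \<bar>y\<bar>))"
    by (intro integral_mono integrable_norm fourier_laplace_integrable int assms)
       (auto simp: norm_mult abs_mult[symmetric] intro!: mult_left_mono)
  finally show ?thesis .
qed

lemma fourier_laplace_holomorphic:
  assumes [measurable]: "k \<in> borel_measurable borel"
    and int: "\<And>r. r \<ge> 0 \<Longrightarrow> integrable lborel (\<lambda>y. cmod (k y) * exp (r * \<bar>y\<bar>))"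
  shows "fourier_laplace k holomorphic_on UNIV"
proof -
  have "(fourier_laplace k has_field_derivative (CLBINT y. k y * exp (\<i> * z * y) * (\<i> * y))) (at z)" for z
    unfolding has_field_derivative_iff tendsto_at_iff_sequentially
  proof (intro allI impI, unfold o_def)
    fix w :: "nat \<Rightarrow> complex"
    assume w: "\<forall>i. w i \<in> UNIV - {z}" and lim: "w \<longlonglongrightarrow> z"
    define v where "v n = w n - z" for n
    have v0: "v n \<noteq> 0" for n using w by (auto simp: v_def)
    have v: "v \<longlonglongrightarrow> 0" unfolding v_def using lim by (rule LIM_zero)
    \<comment> \<open>Domination needs increments of modulus at most 1, so the sequence is shifted
      by N and shifted back at the end.\<close>
    obtain N where N: "\<And>n. n \<ge> N \<Longrightarrow> cmod (v n) \<le> 1"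
      using LIMSEQ_D[OF v, of 1] by (force intro: less_imp_le)
    define q where "q n y = k y * exp (\<i> * z * y) * ((exp (\<i> * v n * y) - 1) / v n)" for n and y :: real
    have quot: "(fourier_laplace k (w n) - fourier_laplace k z) / (w n - z) = (CLBINT y. q n y)" for n
    proof -
      have "fourier_laplace k (w n) - fourier_laplace k z
          = (CLBINT y. k y * exp (\<i> * w n * y) - k y * exp (\<i> * z * y))"
        unfolding fourier_laplace_def
        by (intro Bochner_Integration.integral_diff[symmetric] fourier_laplace_integrable int assms)
      also have "\<dots> / (w n - z) = (CLBINT y. (k y * exp (\<i> * w n * y) - k y * exp (\<i> * z * y)) / (w n - z))"
        by (rule Bochner_Integration.integral_divide_zero[symmetric])
      also have "\<dots> = (CLBINT y. q n y)"
      proof (rule Bochner_Integration.integral_cong)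
        fix y :: real
        have "exp (\<i> * w n * y) = exp (\<i> * z * y) * exp (\<i> * v n * y)"
          by (simp add: v_def mult_exp_exp algebra_simps)
        then show "(k y * exp (\<i> * w n * y) - k y * exp (\<i> * z * y)) / (w n - z) = q n y"
          by (simp add: q_def v_def right_diff_distrib)
      qed simp
      finally show ?thesis .
    qed
    \<comment> \<open>The extra 2 in the exponent of the majorant splits as 1 for the increment, of
      modulus at most 1, and 1 for the factor |y| <= exp |y|.\<close>
    have "(\<lambda>n. CLBINT y. q (n + N) y) \<longlonglongrightarrow> (CLBINT y. k y * exp (\<i> * z * y) * (\<i> * y))"
    proof (rule integral_dominated_convergence[where w = "\<lambda>y. cmod (k y) * exp ((\<bar>Im z\<bar> + 2) * \<bar>y\<bar>)"])
      show "integrable lborel (\<lambda>y. cmod (k y) * exp ((\<bar>Im z\<bar> + 2) * \<bar>y\<bar>))" by (intro int) simp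
      show "q (n + N) \<in> borel_measurable lborel" for n unfolding q_def by measurable
      show "(\<lambda>y. k y * exp (\<i> * z * y) * (\<i> * y)) \<in> borel_measurable lborel" by measurable
      show "AE y in lborel. (\<lambda>n. q (n + N) y) \<longlonglongrightarrow> k y * exp (\<i> * z * y) * (\<i> * y)"
      proof (rule AE_I2)
        fix y :: real
        have "((\<lambda>h. exp (\<i> * h * y)) has_field_derivative \<i> * y) (at 0)"
          by (auto intro!: derivative_eq_intros)
        then have "(\<lambda>n. (exp (\<i> * v n * y) - 1) / v n) \<longlonglongrightarrow> \<i> * y"
          using v v0 unfolding has_field_derivative_iff tendsto_at_iff_sequentially by (auto simp: o_def)
        from LIMSEQ_ignore_initial_segment[OF this, of N]
        show "(\<lambda>n. q (n + N) y) \<longlonglongrightarrow> k y * exp (\<i> * z * y) * (\<i> * y)"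
          unfolding q_def by (intro tendsto_intros)
      qed
      show "AE y in lborel. cmod (q (n + N) y) \<le> cmod (k y) * exp ((\<bar>Im z\<bar> + 2) * \<bar>y\<bar>)" for n
      proof (rule AE_I2)
        fix y :: real
        let ?v = "v (n + N)"
        have "cmod ?v \<le> 1" by (rule N) simp
        have "cmod ((exp (\<i> * ?v * y) - 1) / ?v) \<le> exp \<bar>Re (\<i> * ?v * y)\<bar> * cmod (\<i> * ?v * y) / cmod ?v"
          unfolding norm_divide by (intro divide_right_mono norm_exp_minus_one_le) simp
        also have "\<dots> = exp (\<bar>Im ?v\<bar> * \<bar>y\<bar>) * \<bar>y\<bar>"
          using v0 by (simp add: norm_mult abs_mult)
        also have "\<dots> \<le> exp (1 * \<bar>y\<bar>) * exp \<bar>y\<bar>"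
        proof (rule mult_mono)
          show "exp (\<bar>Im ?v\<bar> * \<bar>y\<bar>) \<le> exp (1 * \<bar>y\<bar>)"
            unfolding exp_le_cancel_iff
            by (rule mult_right_mono[OF order_trans[OF abs_Im_le_cmod \<open>cmod ?v \<le> 1\<close>]]) simp
          show "\<bar>y\<bar> \<le> exp \<bar>y\<bar>" using exp_ge_add_one_self[of "\<bar>y\<bar>"] by linarith
        qed auto
        finally have 1: "cmod ((exp (\<i> * ?v * y) - 1) / ?v) \<le> exp (2 * \<bar>y\<bar>)"
          by (simp add: mult_exp_exp)
        have 2: "cmod (exp (\<i> * z * y)) \<le> exp (\<bar>Im z\<bar> * \<bar>y\<bar>)"
          by (simp add: abs_mult[symmetric])
        have "cmod (q (n + N) y) \<le> cmod (k y) * exp (\<bar>Im z\<bar> * \<bar>y\<bar>) * exp (2 * \<bar>y\<bar>)"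
          unfolding q_def norm_mult[of _ "_ / _"] norm_mult[of "k y"]
          by (intro mult_mono 1 2 mult_left_mono) auto
        then show "cmod (q (n + N) y) \<le> cmod (k y) * exp ((\<bar>Im z\<bar> + 2) * \<bar>y\<bar>)"
          by (simp add: mult.assoc mult_exp_exp distrib_right)
      qed
    qed
    then have "(\<lambda>n. CLBINT y. q n y) \<longlonglongrightarrow> (CLBINT y. k y * exp (\<i> * z * y) * (\<i> * y))"
      by (rule LIMSEQ_offset)
    then show "(\<lambda>n. (fourier_laplace k (w n) - fourier_laplace k z) / (w n - z))
        \<longlonglongrightarrow> (CLBINT y. k y * exp (\<i> * z * y) * (\<i> * y))"
      by (simp add: quot)
  qed
  then show ?thesis by (auto simp: holomorphic_on_def field_differentiable_def)
qed

text \<open>Fourier inversion with a Gaussian cutoff: after Fubini the inner integral is the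
  characteristic function of the standard normal law at \<open>x - t\<close>, which is sqrt(2 pi)
  times its density. The cutoff therefore yields g convolved with a Gaussian.\<close>

lemma fourier_laplace_gaussian:
  fixes g :: "real \<Rightarrow> complex"
  assumes g: "integrable lborel g"
  shows "fourier_laplace (\<lambda>y. fourier g y * std_normal_density y) (of_real x)
    = sqrt (2 * pi) * (CLBINT t. g t * std_normal_density (x - t))"
proof -
  interpret lborel_pair: pair_sigma_finite lborel lborel ..
  have [measurable]: "g \<in> borel_measurable borel" using g by simp
  define F where "F y t = (g t * iexp (- (t * y))) * (std_normal_density y * iexp (x * y))" for y t :: real
  have nF: "cmod (F y t) = cmod (g t) * std_normal_density y" for y t
    by (simp add: F_def norm_mult)
  have intF: "integrable (lborel \<Otimes>\<^sub>M lborel) (case_prod F)"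
  proof (rule lborel_pair.Fubini_integrable)
    show "case_prod F \<in> borel_measurable (lborel \<Otimes>\<^sub>M lborel)"
      unfolding F_def by measurable
    show "integrable lborel (\<lambda>y. LBINT t. cmod (case (y, t) of (y, t) \<Rightarrow> F y t))"
      by (simp add: nF)
    show "AE y in lborel. integrable lborel (\<lambda>t. case (y, t) of (y, t) \<Rightarrow> F y t)"
      unfolding F_def prod.case
      by (intro AE_I2 integrable_mult_left integrable_fourier_integrand g)
  qed
  have "fourier_laplace (\<lambda>y. fourier g y * std_normal_density y) (of_real x) = (CLBINT y. CLBINT t. F y t)"
    unfolding fourier_laplace_def fourier_def F_def integral_mult_left_zero
    by (simp add: mult.assoc)
  also have "\<dots> = (CLBINT t. CLBINT y. F y t)"
    by (rule lborel_pair.Fubini_integral[OF intF, symmetric])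
  also have "\<dots> = (CLBINT t. sqrt (2 * pi) * (g t * std_normal_density (x - t)))"
  proof (rule Bochner_Integration.integral_cong)
    fix t :: real
    have "(CLBINT y. F y t) = (CLBINT y. g t * (std_normal_density y *\<^sub>R iexp ((x - t) * y)))"
      by (intro Bochner_Integration.integral_cong)
         (auto simp: F_def scaleR_conv_of_real mult_exp_exp algebra_simps)
    also have "\<dots> = g t * (CLBINT y. std_normal_density y *\<^sub>R iexp ((x - t) * y))"
      by (rule integral_mult_right_zero)
    also have "\<dots> = g t * char std_normal_distribution (x - t)"
      unfolding char_def by (simp add: integral_density)
    also have "\<dots> = sqrt (2 * pi) * (g t * std_normal_density (x - t))"
      unfolding char_std_normal_distribution by (simp add: std_normal_density_def)
    finally show "(CLBINT y. F y t) = sqrt (2 * pi) * (g t * std_normal_density (x - t))" .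
  qed simp
  finally show ?thesis by simp
qed

subsection \<open>Beurling's theorem\<close>

text \<open>Substituting t + x for x and using |t + x| <= |t| + |x| moves the weight from x to t at
  the cost of a Gaussian moment.\<close>

lemma gaussian_exp_translate_le:
  fixes r t :: real
  assumes r: "r \<ge> 0"
  shows "(\<integral>\<^sup>+ x. ennreal (std_normal_density (x - t) * exp (r * \<bar>x\<bar>)) \<partial>lborel)
    \<le> ennreal (2 * exp (r\<^sup>2 / 2) * exp (r * \<bar>t\<bar>))"
proof -
  have "(\<integral>\<^sup>+ x. ennreal (std_normal_density (x - t) * exp (r * \<bar>x\<bar>)) \<partial>lborel)
      = (\<integral>\<^sup>+ x. ennreal (std_normal_density x * exp (r * \<bar>t + x\<bar>)) \<partial>lborel)"
    by (subst nn_integral_real_affine[where c = 1 and t = t]) auto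
  also have "\<dots> \<le> (\<integral>\<^sup>+ x. ennreal (std_normal_density x * exp (r * \<bar>x\<bar>) * exp (r * \<bar>t\<bar>)) \<partial>lborel)"
  proof (intro nn_integral_mono ennreal_leI)
    fix x :: real
    have "r * \<bar>t + x\<bar> \<le> r * \<bar>x\<bar> + r * \<bar>t\<bar>"
      using mult_left_mono[OF abs_triangle_ineq[of t x] r] by (simp add: algebra_simps)
    then show "std_normal_density x * exp (r * \<bar>t + x\<bar>) \<le> std_normal_density x * exp (r * \<bar>x\<bar>) * exp (r * \<bar>t\<bar>)"
      unfolding mult.assoc mult_exp_exp by (intro mult_left_mono) auto
  qed
  also have "\<dots> = ennreal (LBINT x. std_normal_density x * exp (r * \<bar>x\<bar>) * exp (r * \<bar>t\<bar>))"
    by (intro nn_integral_eq_integral integrable_mult_left integral_normal_density_exp_abs_le r AE_I2) auto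
  also have "\<dots> \<le> ennreal (2 * exp (r\<^sup>2 / 2) * exp (r * \<bar>t\<bar>))"
    using integral_normal_density_exp_abs_le(2)[OF r] by (intro ennreal_leI) simp
  finally show ?thesis .
qed

theorem beurling_fourier:
  fixes g :: "real \<Rightarrow> complex"
  assumes g: "integrable lborel g"
    and fin: "(\<integral>\<^sup>+ t. \<integral>\<^sup>+ y. ennreal (cmod (g t) * cmod (fourier g y) * exp \<bar>t * y\<bar>) \<partial>lborel \<partial>lborel) < \<infinity>"
  shows "AE t in lborel. g t = 0"
proof -
  interpret lborel_pair: pair_sigma_finite lborel lborel ..
  have [measurable]: "g \<in> borel_measurable borel" using g by simp
  have hm [measurable]: "fourier g \<in> borel_measurable borel"
    by (rule borel_measurable_continuous_onI[OF continuous_fourier[OF g]])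
  define k where "k y = fourier g y * std_normal_density y" for y
  have km [measurable]: "k \<in> borel_measurable borel" unfolding k_def by measurable
  define K where "K = (LBINT t. cmod (g t))"
  have K0: "K \<ge> 0" unfolding K_def by simp
  have k_le: "cmod (k y) * exp (r * \<bar>y\<bar>) \<le> K * (std_normal_density y * exp (r * \<bar>y\<bar>))" for r y :: real
    using norm_fourier_le[OF g, of y] unfolding k_def K_def[symmetric]
    by (simp add: norm_mult mult.assoc mult_right_mono)
  have kint: "integrable lborel (\<lambda>y. cmod (k y) * exp (r * \<bar>y\<bar>))" if "r \<ge> 0" for r
    by (rule Bochner_Integration.integrable_bound[OF integrable_mult_right[OF integral_normal_density_exp_abs_le(1)[OF that], of K]])
       (use k_le K0 in \<open>auto simp: abs_mult\<close>)
  \<comment> \<open>M bounds |G| on horizontal lines and is also an explicit integral, so that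
    integrability of \<open>cmod (G x) * M \<bar>x\<bar>\<close> can be read off a triple
    integral.\<close>
  define M where "M r = (LBINT y. cmod (k y) * exp (r * \<bar>y\<bar>))" for r :: real
  have M0: "M r \<ge> 0" for r unfolding M_def by simp
  have Mmeas [measurable]: "M \<in> borel_measurable borel" unfolding M_def by measurable
  have Mmono: "M x \<le> M y" if "0 \<le> x" "x \<le> y" for x y
    unfolding M_def using that
    by (intro integral_mono kint mult_left_mono) (auto intro: mult_right_mono)
  have Mgrowth: "M r \<le> (2 * K) * exp (1 / 2 * r\<^sup>2)" if "r \<ge> 0" for r
  proof -
    have "M r \<le> (LBINT y. K * (std_normal_density y * exp (r * \<bar>y\<bar>)))"
      unfolding M_def
      by (intro integral_mono kint that integrable_mult_right integral_normal_density_exp_abs_le k_le)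
    also have "\<dots> \<le> K * (2 * exp (r\<^sup>2 / 2))"
      using mult_left_mono[OF integral_normal_density_exp_abs_le(2)[OF that] K0] by simp
    finally show ?thesis by (simp add: mult_ac)
  qed
  have Mnn: "ennreal (M r) = (\<integral>\<^sup>+ y. ennreal (cmod (k y) * exp (r * \<bar>y\<bar>)) \<partial>lborel)" if "r \<ge> 0" for r
    unfolding M_def by (rule nn_integral_eq_integral[symmetric]) (use kint[OF that] in auto)
  define G where "G = fourier_laplace k"
  have Ghol: "G holomorphic_on UNIV"
    unfolding G_def by (rule fourier_laplace_holomorphic[OF km kint])
  have Gle: "cmod (G z) \<le> M \<bar>Im z\<bar>" for z
    unfolding G_def M_def by (rule norm_fourier_laplace_le[OF km kint])
  have Gcont: "continuous_on UNIV G" using Ghol holomorphic_on_imp_continuous_on by blast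
  have [measurable]: "G \<in> borel_measurable borel" by (rule borel_measurable_continuous_onI[OF Gcont])
  define s where "s = sqrt (2 * pi)"
  have s0: "s > 0" by (simp add: s_def)
  define V where "V t y = cmod (g t) * cmod (fourier g y) * exp \<bar>t * y\<bar>" for t y
  define W where "W x t y = cmod (g t) * std_normal_density (x - t) * (cmod (k y) * exp (\<bar>x\<bar> * \<bar>y\<bar>))" for x t y
  have Gnn: "ennreal (cmod (G (of_real x))) \<le> ennreal s * (\<integral>\<^sup>+ t. ennreal (cmod (g t) * std_normal_density (x - t)) \<partial>lborel)" for x
  proof -
    have "G (of_real x) = s * (CLBINT t. g t * std_normal_density (x - t))"
      unfolding G_def k_def[abs_def] s_def by (rule fourier_laplace_gaussian[OF g])
    then have "ennreal (cmod (G (of_real x))) = ennreal s * ennreal (cmod (CLBINT t. g t * std_normal_density (x - t)))"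
      using s0 by (simp add: norm_mult ennreal_mult')
    also have "ennreal (cmod (CLBINT t. g t * std_normal_density (x - t)))
        \<le> (\<integral>\<^sup>+ t. ennreal (cmod (g t * std_normal_density (x - t))) \<partial>lborel)"
      \<comment> \<open>In the non-integrable case the integral is 0 by convention and the bound is
        trivial.\<close>
      by (cases "complex_integrable lborel (\<lambda>t. g t * std_normal_density (x - t))")
         (auto simp: not_integrable_integral_eq intro: integral_norm_bound_ennreal)
    finally show ?thesis by (simp add: norm_mult mult_left_mono)
  qed
  \<comment> \<open>|G x| is at most s times the convolution of |g| with the Gaussian, an integral
    in t, and M is an integral in y; their product is the double integral of W.\<close>
  have pointwise: "ennreal (cmod (G (of_real x)) * M \<bar>x\<bar>) \<le> ennreal s * (\<integral>\<^sup>+ t. \<integral>\<^sup>+ y. ennreal (W x t y) \<partial>lborel \<partial>lborel)" for x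
  proof -
    have "ennreal (cmod (G (of_real x)) * M \<bar>x\<bar>) = ennreal (cmod (G (of_real x))) * ennreal (M \<bar>x\<bar>)"
      by (rule ennreal_mult') simp
    also have "\<dots> \<le> (ennreal s * (\<integral>\<^sup>+ t. ennreal (cmod (g t) * std_normal_density (x - t)) \<partial>lborel)) * ennreal (M \<bar>x\<bar>)"
      by (intro mult_right_mono Gnn) simp
    also have "\<dots> = ennreal s * (\<integral>\<^sup>+ t. ennreal (cmod (g t) * std_normal_density (x - t)) * ennreal (M \<bar>x\<bar>) \<partial>lborel)"
      by (subst nn_integral_multc) (auto simp: mult.assoc)
    also have "(\<integral>\<^sup>+ t. ennreal (cmod (g t) * std_normal_density (x - t)) * ennreal (M \<bar>x\<bar>) \<partial>lborel)
        = (\<integral>\<^sup>+ t. \<integral>\<^sup>+ y. ennreal (W x t y) \<partial>lborel \<partial>lborel)"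
      unfolding W_def Mnn[OF abs_ge_zero]
      by (intro nn_integral_cong, subst nn_integral_cmult[symmetric]) (auto simp: ennreal_mult')
    finally show ?thesis .
  qed
  \<comment> \<open>The factor \<open>exp (y\<^sup>2 / 2)\<close> lost by convolving \<open>g\<close> with the Gaussian is exactly cancelled by the Gaussian in \<open>k\<close>.\<close>
  have inner: "(\<integral>\<^sup>+ x. ennreal (W x t y) \<partial>lborel) \<le> ennreal (2 / s) * ennreal (V t y)" for t y
  proof -
    have "(\<integral>\<^sup>+ x. ennreal (W x t y) \<partial>lborel)
        = (\<integral>\<^sup>+ x. ennreal (cmod (g t) * cmod (k y)) * ennreal (std_normal_density (x - t) * exp (\<bar>y\<bar> * \<bar>x\<bar>)) \<partial>lborel)"
      by (intro nn_integral_cong, subst ennreal_mult[symmetric]) (auto simp: W_def mult_ac)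
    also have "\<dots> = ennreal (cmod (g t) * cmod (k y)) * (\<integral>\<^sup>+ x. ennreal (std_normal_density (x - t) * exp (\<bar>y\<bar> * \<bar>x\<bar>)) \<partial>lborel)"
      by (rule nn_integral_cmult) measurable
    also have "\<dots> \<le> ennreal (cmod (g t) * cmod (k y)) * ennreal (2 * exp (\<bar>y\<bar>\<^sup>2 / 2) * exp (\<bar>y\<bar> * \<bar>t\<bar>))"
      by (intro mult_left_mono gaussian_exp_translate_le) auto
    also have "\<dots> = ennreal (cmod (g t) * cmod (k y) * (2 * exp (\<bar>y\<bar>\<^sup>2 / 2) * exp (\<bar>y\<bar> * \<bar>t\<bar>)))"
      by (simp add: ennreal_mult)
    also have "cmod (g t) * cmod (k y) * (2 * exp (\<bar>y\<bar>\<^sup>2 / 2) * exp (\<bar>y\<bar> * \<bar>t\<bar>)) = 2 / s * V t y"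
    proof -
      have "std_normal_density y * exp (\<bar>y\<bar>\<^sup>2 / 2) = 1 / s"
        by (simp add: std_normal_density_def s_def mult_exp_exp)
      then have "cmod (k y) * exp (\<bar>y\<bar>\<^sup>2 / 2) = cmod (fourier g y) / s"
        by (simp add: k_def norm_mult mult.assoc)
      moreover have "\<bar>y\<bar> * \<bar>t\<bar> = \<bar>t * y\<bar>" by (simp add: abs_mult)
      ultimately show ?thesis by (simp add: V_def mult_ac)
    qed
    also have "ennreal (2 / s * V t y) = ennreal (2 / s) * ennreal (V t y)"
      using s0 by (intro ennreal_mult) (auto simp: V_def)
    finally show ?thesis .
  qed
  have "(\<integral>\<^sup>+ x. ennreal (cmod (G (of_real x)) * M \<bar>x\<bar>) \<partial>lborel)
      \<le> (\<integral>\<^sup>+ x. ennreal s * (\<integral>\<^sup>+ t. \<integral>\<^sup>+ y. ennreal (W x t y) \<partial>lborel \<partial>lborel) \<partial>lborel)"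
    by (intro nn_integral_mono pointwise)
  also have "\<dots> = ennreal s * (\<integral>\<^sup>+ x. \<integral>\<^sup>+ t. \<integral>\<^sup>+ y. ennreal (W x t y) \<partial>lborel \<partial>lborel \<partial>lborel)"
    unfolding W_def by (rule nn_integral_cmult) measurable
  \<comment> \<open>Two applications of Tonelli move the integration in x to the innermost place,
    where \<open>inner\<close> applies.\<close>
  also have "(\<integral>\<^sup>+ x. \<integral>\<^sup>+ t. \<integral>\<^sup>+ y. ennreal (W x t y) \<partial>lborel \<partial>lborel \<partial>lborel)
      = (\<integral>\<^sup>+ t. \<integral>\<^sup>+ x. \<integral>\<^sup>+ y. ennreal (W x t y) \<partial>lborel \<partial>lborel \<partial>lborel)"
    unfolding W_def by (rule lborel_pair.Fubini') measurable
  also have "\<dots> = (\<integral>\<^sup>+ t. \<integral>\<^sup>+ y. \<integral>\<^sup>+ x. ennreal (W x t y) \<partial>lborel \<partial>lborel \<partial>lborel)"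
    unfolding W_def by (intro nn_integral_cong lborel_pair.Fubini') measurable
  also have "\<dots> \<le> (\<integral>\<^sup>+ t. \<integral>\<^sup>+ y. ennreal (2 / s) * ennreal (V t y) \<partial>lborel \<partial>lborel)"
    by (intro nn_integral_mono inner)
  also have "\<dots> = ennreal (2 / s) * (\<integral>\<^sup>+ t. \<integral>\<^sup>+ y. ennreal (V t y) \<partial>lborel \<partial>lborel)"
    unfolding V_def by (subst nn_integral_cmult, measurable)+
  finally have "(\<integral>\<^sup>+ x. ennreal (cmod (G (of_real x)) * M \<bar>x\<bar>) \<partial>lborel)
      \<le> ennreal s * (ennreal (2 / s) * (\<integral>\<^sup>+ t. \<integral>\<^sup>+ y. ennreal (V t y) \<partial>lborel \<partial>lborel))"
    by (simp add: mult_left_mono)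
  also have "\<dots> < \<infinity>"
    using fin unfolding V_def by (intro ennreal_mult_less_top[THEN iffD2] disjI2 conjI | simp add: ennreal_mult_less_top)+
  finally have Gint: "integrable lborel (\<lambda>x. cmod (G (of_real x)) * M \<bar>x\<bar>)"
    by (intro integrableI_bounded) (auto simp: M0)
  have G_zero: "G z = 0" for z
    by (rule beurling_entire_vanishes[OF Ghol Mmono Gle Mgrowth _ Gint]) simp_all
  have "fourier k y = G (of_real (- y))" for y
    unfolding G_def fourier_laplace_def fourier_def
    by (intro Bochner_Integration.integral_cong) (auto simp: mult_ac)
  then have "fourier k y = 0" for y by (simp add: G_zero)
  moreover have "integrable lborel k"
    using fourier_laplace_integrable[OF km kint, of 0] by simp
  ultimately have "AE y in lborel. k y = 0" by (intro AE_zero_of_fourier_zero)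
  then have "AE y in lborel. fourier g y = 0"
    by eventually_elim (auto simp: k_def normal_density_def)
  \<comment> \<open>The almost everywhere zero of \<open>fourier g\<close> is upgraded by
    continuity: the set where it is nonzero is open and null, hence empty.\<close>
  moreover have op: "open {y. fourier g y \<noteq> 0}"
    by (rule open_Collect_neq[OF continuous_fourier[OF g]]) simp
  ultimately have "{y. fourier g y \<noteq> 0} \<in> null_sets lborel"
    by (subst AE_iff_null_sets) auto
  then have "negligible {y. fourier g y \<noteq> 0}"
    by (simp add: negligible_iff_null_sets null_sets_completionI)
  with op have "fourier g y = 0" for y
    using open_not_negligible[of "{y. fourier g y \<noteq> 0}"] by blast
  then show ?thesis by (rule AE_zero_of_fourier_zero[OF g])
qed

subsection \<open>The offset linear canonical transform\<close>

text \<open>The Fubini arguments above take place on \<open>lborel\<close>, so a Lebesgue integrable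
  function is first replaced by a Borel representative, chosen for real and imaginary parts
  separately.\<close>

lemma integrable_lebesgue_ex_borel:
  fixes f :: "real \<Rightarrow> complex"
  assumes f: "integrable lebesgue f"
  obtains f0 where "f0 \<in> borel_measurable borel" "AE t in lborel. f t = f0 t" "integrable lborel f0"
proof -
  have "(\<lambda>t. Re (f t)) \<in> borel_measurable lebesgue" "(\<lambda>t. Im (f t)) \<in> borel_measurable lebesgue"
    using borel_measurable_integrable[OF f] by measurable
  then obtain p q :: "real \<Rightarrow> real" where pq [measurable]: "p \<in> borel_measurable borel" "q \<in> borel_measurable borel"
    and ae: "AE t in lborel. Re (f t) = p t" "AE t in lborel. Im (f t) = q t"
    by (auto dest!: completion_ex_borel_measurable_real)
  define f0 where "f0 t = of_real (p t) + \<i> * of_real (q t)" for t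
  have m [measurable]: "f0 \<in> borel_measurable borel" unfolding f0_def by measurable
  have eq: "AE t in lborel. f t = f0 t"
    using ae by eventually_elim (simp add: f0_def complex_eq_iff)
  have m': "f0 \<in> borel_measurable lebesgue"
    by (rule measurable_completion) (simp add: m)
  have "integrable lebesgue f0"
    by (rule integrable_cong_AE_imp[OF f]) (use AE_completion[OF eq] m' in auto)
  then have "integrable lborel f0" by (simp add: integrable_completion)
  with m eq that show thesis by blast
qed

text \<open>The cylinder over a null set is null in the plane. This carries the change of
  representative over to the double integral.\<close>

lemma AE_lborel_fst:
  assumes "AE t in (lborel :: real measure). P t"
  shows "AE p in (lborel :: (real \<times> real) measure). P (fst p)"
proof -
  obtain N where N: "N \<in> null_sets (lborel :: real measure)" "\<And>t. t \<in> space lborel - N \<Longrightarrow> P t"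
    using AE_E3[OF assms] by metis
  have "N \<times> (UNIV :: real set) \<in> null_sets (lborel \<Otimes>\<^sub>M lborel)"
    using N(1) lborel.emeasure_pair_measure_Times[of N lborel "UNIV :: real set"]
    by (intro null_setsI) (auto simp: null_setsD1 null_setsD2 dest: null_setsD1)
  then have "N \<times> (UNIV :: real set) \<in> null_sets (lborel :: (real \<times> real) measure)"
    by (simp add: lborel_prod)
  then show ?thesis by (rule AE_I') (use N(2) in force)
qed

text \<open>In the expanded exponent the terms in t alone form a chirp, the cross term is the
  Fourier phase at frequency \<open>u / b\<close>, and the rest depends only on u and is purely
  imaginary.\<close>

lemma olct_eq_fourier:
  fixes f :: "real \<Rightarrow> complex"
  assumes f0: "f0 \<in> borel_measurable borel" "AE t in lborel. f t = f0 t"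
    and f: "f \<in> borel_measurable lebesgue"
  shows "olct a b c d \<tau> \<eta> f u = 1 / csqrt (\<i> * of_real (2 * pi * b))
      * iexp (d / (2 * b) * (u\<^sup>2 + \<tau>\<^sup>2) - 1 / b * u * (d * \<tau> - b * \<eta>))
      * fourier (\<lambda>t. f0 t * iexp (a / (2 * b) * t\<^sup>2 + \<tau> / b * t)) (u / b)"
proof -
  note f0(1) [measurable]
  have [measurable]: "(\<lambda>t. olct_kernel a b c d \<tau> \<eta> t u) \<in> borel_measurable borel"
    unfolding olct_kernel_def by measurable
  have kernel: "olct_kernel a b c d \<tau> \<eta> t u = 1 / csqrt (\<i> * of_real (2 * pi * b))
      * iexp (d / (2 * b) * (u\<^sup>2 + \<tau>\<^sup>2) - 1 / b * u * (d * \<tau> - b * \<eta>))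
      * (iexp (a / (2 * b) * t\<^sup>2 + \<tau> / b * t) * iexp (- (t * (u / b))))" for t
    unfolding olct_kernel_def mult.assoc mult_exp_exp
    by (intro arg_cong2[of _ _ _ _ "(*)"] arg_cong[of _ _ exp] refl)
       (simp add: algebra_simps diff_divide_distrib add_divide_distrib)
  have "olct a b c d \<tau> \<eta> f u = (LINT t|lebesgue. f0 t * olct_kernel a b c d \<tau> \<eta> t u)"
    unfolding olct_def
  proof (rule integral_cong_AE)
    have "(\<lambda>t. olct_kernel a b c d \<tau> \<eta> t u) \<in> borel_measurable lebesgue" "f0 \<in> borel_measurable lebesgue"
      by (rule measurable_completion, simp)+
    then show "(\<lambda>t. f t * olct_kernel a b c d \<tau> \<eta> t u) \<in> borel_measurable lebesgue"
      "(\<lambda>t. f0 t * olct_kernel a b c d \<tau> \<eta> t u) \<in> borel_measurable lebesgue"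
      using f by (auto intro: borel_measurable_times)
    show "AE t in lebesgue. f t * olct_kernel a b c d \<tau> \<eta> t u = f0 t * olct_kernel a b c d \<tau> \<eta> t u"
      using AE_completion[OF f0(2)] by eventually_elim simp
  qed
  also have "\<dots> = (CLBINT t. f0 t * olct_kernel a b c d \<tau> \<eta> t u)"
    by (rule integral_completion) measurable
  also have "\<dots> = 1 / csqrt (\<i> * of_real (2 * pi * b))
      * iexp (d / (2 * b) * (u\<^sup>2 + \<tau>\<^sup>2) - 1 / b * u * (d * \<tau> - b * \<eta>))
      * fourier (\<lambda>t. f0 t * iexp (a / (2 * b) * t\<^sup>2 + \<tau> / b * t)) (u / b)"
    unfolding fourier_def kernel integral_mult_right_zero[symmetric]
    by (intro Bochner_Integration.integral_cong) (simp_all only: mult_ac)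
  finally show ?thesis .
qed

theorem theorem3p6:
  fixes a b c d \<tau> \<eta> :: real and f :: "real \<Rightarrow> complex"
  assumes "a * d - b * c = 1" and "b > 0"
    and "integrable lebesgue f"
    and "integrable lebesgue (olct a b c d \<tau> \<eta> f)"
    and "(\<integral>\<^sup>+ (t, u). ennreal (cmod (f t * olct a b c d \<tau> \<eta> f u) * exp \<bar>t * u / b\<bar>)
            \<partial>(lebesgue :: (real \<times> real) measure)) < \<infinity>"
  shows "AE t in lebesgue. f t = 0"
proof -
  obtain f0 where f0m [measurable]: "f0 \<in> borel_measurable borel"
    and eq: "AE t in lborel. f t = f0 t" and f0: "integrable lborel f0"
    using integrable_lebesgue_ex_borel[OF assms(3)] by blast
  define g where "g t = f0 t * iexp (a / (2 * b) * t\<^sup>2 + \<tau> / b * t)" for t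
  have [measurable]: "g \<in> borel_measurable borel" unfolding g_def by measurable
  have ng: "cmod (g t) = cmod (f0 t)" for t by (simp add: g_def norm_mult)
  have g: "integrable lborel g"
    by (rule Bochner_Integration.integrable_bound[OF f0]) (auto simp: ng)
  have hm [measurable]: "fourier g \<in> borel_measurable borel"
    by (rule borel_measurable_continuous_onI[OF continuous_fourier[OF g]])
  define C where "C = 1 / sqrt (2 * pi * b)"
  have C: "C > 0" using \<open>b > 0\<close> by (simp add: C_def)
  \<comment> \<open>The phase in u has modulus 1 and the square root has modulus sqrt(2 pi b), so
    only the constant \<open>C\<close> and the dilation by b remain.\<close>
  have nO: "cmod (olct a b c d \<tau> \<eta> f u) = C * cmod (fourier g (u / b))" for u
    using \<open>b > 0\<close> unfolding olct_eq_fourier[OF f0m eq borel_measurable_integrable[OF assms(3)]] g_def[symmetric, abs_def] C_def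
    by (simp add: norm_mult norm_divide)
  define V where "V t y = cmod (g t) * cmod (fourier g y) * exp \<bar>t * y\<bar>" for t y
  have [measurable]: "(\<lambda>(t, y). V t y) \<in> borel_measurable (borel \<Otimes>\<^sub>M borel)"
    unfolding V_def by measurable
  have meas: "(\<lambda>(t, u). ennreal (C * V t (u / b))) \<in> borel_measurable (lborel \<Otimes>\<^sub>M lborel)"
    unfolding V_def by measurable
  \<comment> \<open>Only the factor \<open>f t\<close> needs an almost everywhere replacement; the
    modulus of the transform is given at every u by \<open>nO\<close>.\<close>
  have "AE p in lebesgue. f (fst p) = f0 (fst (p :: real \<times> real))"
    by (rule AE_completion[OF AE_lborel_fst[OF eq]])
  then have "(\<integral>\<^sup>+ (t, u). ennreal (cmod (f t * olct a b c d \<tau> \<eta> f u) * exp \<bar>t * u / b\<bar>)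
            \<partial>(lebesgue :: (real \<times> real) measure))
      = (\<integral>\<^sup>+ (t, u). ennreal (C * V t (u / b)) \<partial>(lebesgue :: (real \<times> real) measure))"
    by (intro nn_integral_cong_AE, eventually_elim)
       (auto simp: V_def norm_mult nO ng mult_ac split: prod.splits)
  also have "\<dots> = (\<integral>\<^sup>+ (t, u). ennreal (C * V t (u / b)) \<partial>(lborel \<Otimes>\<^sub>M lborel))"
    by (simp add: nn_integral_completion lborel_prod)
  also have "\<dots> = (\<integral>\<^sup>+ t. \<integral>\<^sup>+ u. ennreal (C * V t (u / b)) \<partial>lborel \<partial>lborel)"
    using lborel.nn_integral_fst[OF meas] by simp
  also have "\<dots> = (\<integral>\<^sup>+ t. ennreal (C * b) * (\<integral>\<^sup>+ y. ennreal (V t y) \<partial>lborel) \<partial>lborel)"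
  \<comment> \<open>The substitution u = b y turns the weight exp |t u / b| into exp |t y| and
    contributes the Jacobian b.\<close>
  proof (intro nn_integral_cong)
    fix t :: real
    have [measurable]: "V t \<in> borel_measurable borel" unfolding V_def by measurable
    have "(\<integral>\<^sup>+ u. ennreal (C * V t (u / b)) \<partial>lborel) = ennreal \<bar>b\<bar> * (\<integral>\<^sup>+ y. ennreal (C * V t y) \<partial>lborel)"
      using \<open>b > 0\<close> by (subst nn_integral_real_affine[where c = b and t = 0]) auto
    also have "\<dots> = ennreal b * (ennreal C * (\<integral>\<^sup>+ y. ennreal (V t y) \<partial>lborel))"
      using \<open>b > 0\<close> C by (simp add: ennreal_mult' nn_integral_cmult)
    finally show "(\<integral>\<^sup>+ u. ennreal (C * V t (u / b)) \<partial>lborel) = ennreal (C * b) * (\<integral>\<^sup>+ y. ennreal (V t y) \<partial>lborel)"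
      using \<open>b > 0\<close> C by (simp add: ennreal_mult' mult_ac)
  qed
  also have "\<dots> = ennreal (C * b) * (\<integral>\<^sup>+ t. \<integral>\<^sup>+ y. ennreal (V t y) \<partial>lborel \<partial>lborel)"
    unfolding V_def by (rule nn_integral_cmult) measurable
  finally have "ennreal (C * b) * (\<integral>\<^sup>+ t. \<integral>\<^sup>+ y. ennreal (V t y) \<partial>lborel \<partial>lborel) < \<infinity>"
    using assms(5) by simp
  moreover have "ennreal (C * b) \<noteq> 0" using C \<open>b > 0\<close> by simp
  ultimately have "(\<integral>\<^sup>+ t. \<integral>\<^sup>+ y. ennreal (V t y) \<partial>lborel \<partial>lborel) < \<infinity>"
    by (auto simp: ennreal_mult_less_top)
  then have "AE t in lborel. g t = 0"
    unfolding V_def by (rule beurling_fourier[OF g])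
  with eq have "AE t in lborel. f t = 0"
    by eventually_elim (simp add: g_def)
  then show ?thesis by (rule AE_completion)
qed

end
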